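(* Let $a\in\mathcal{A}$. The conditional probability, under $\mu'$, that $A'_{i'j'}=1$ given $A=a$ (that is, given $A'_{ij}=a_{ij}$ for all $(i,j)\in E$) is $$\mu'(A'_{i'j'}=1\mid A=a)=\frac{1}{1+\sqrt{1+\beta\delta_{i'j'}(a)}}$$ or, equivalently, $$\mu'(A'_{i'j'}=1\mid A=a)=\frac{\sqrt{\delta_1(a)}}{\sqrt{\delta_0(a)}+\sqrt{\delta_1(a)}}.$$
   Context: Let $\alpha>0$ and $\beta\ge 0$ be fixed parameters. Let $G=(V,E)$ be a finite simple undirected graph with $V=\{1,\dots,m\}$; $(i,j)$ denotes the edge joining $i$ and $j$. Let $\mathcal{A}$ (identified with $\{0,1\}^E$) be the set of symmetric $0$-$1$ $m\times m$ matrices $a=(a_{ij})$ with zero diagonal and with $a_{ij}=0$ whenever $(i,j)\notin E$. Let $e_i\in\mathbb{R}^m$ be the $i$th standard basis column vector. For $a\in\mathcal{A}$ define $$Q(a)=\alpha I+\beta\sum_{(i,j)\in E}a_{ij}(e_i-e_j)(e_i-e_j)^T,\qquad \Sigma(a)=Q(a)^{-1}$$ (each edge counted once; $Q(a)$ is positive definite). Let $i',j'\in V$ be distinct nodes with $(i',j')\notin E$, and let $E'=E\cup\{(i',j')\}$. Let $\mathcal{A}'=\{a+a'_{i'j'}(e_{i'}e_{j'}^T+e_{j'}e_{i'}^T): a\in\mathcal{A},\ a'_{i'j'}\in\{0,1\}\}$ be the corresponding set of adjacency matrices for $(V,E')$, and for $a'\in\mathcal{A}'$ of this form define $$Q'(a')=Q(a)+\beta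 a'_{i'j'}(e_{i'}-e_{j'})(e_{i'}-e_{j'})^T,\qquad \Sigma'(a')=Q'(a')^{-1}.$$ Write $\sigma_{ij}$ and $\sigma'_{ij}$ for the entries of $\Sigma(a)$ and $\Sigma'(a')$ respectively, and $\delta_{ij}(a)=\sigma_{ii}+\sigma_{jj}-2\sigma_{ij}$, $\delta'_{ij}(a')=\sigma'_{ii}+\sigma'_{jj}-2\sigma'_{ij}$. For $a\in\mathcal{A}$, let $\delta_1(a)$ (respectively $\delta_0(a)$) be the value of $\delta'_{i'j'}(a')$ at the $a'\in\mathcal{A}'$ with $a'_{ij}=a_{ij}$ for $(i,j)\in E$ and $a'_{i'j'}=1$ (respectively $a'_{i'j'}=0$). The random adjacency matrix $A'$ with values in $\mathcal{A}'$ has, under $\mu'$, the distribution $$\mu'(A'=a')=\frac{|\Sigma'(a')|^{1/2}}{\sum_{b'\in\mathcal{A}'}|\Sigma'(b')|^{1/2}},\qquad a'\in\mathcal{A}',$$ where $|\cdot|$ is the determinant. This is the marginal distribution of the adjacency matrix under the joint density on $\mathcal{A}'\times\mathbb{R}^m$ proportional to $\exp\{-\frac12 x^TQ'(a')x\}$. $A$ denotes the part of $A'$ on the edges $E$, so that $A'=A+A'_{i'j'}(e_{i'}e_{j'}^T+e_{j'}e_{i'}^T)$. *)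

theory Defs
  imports "HOL-Probability.Probability"
begin

text \<open>The vertex set \<open>{1,\<dots>,m}\<close> is a finite linearly ordered type; the order only serves
  to pick one orientation of each undirected edge.\<close>

text \<open>Written without the \<open>^\<close> syntax, which would force the sort of the index type to be
  exactly \<open>finite\<close>.\<close>

type_synonym 'n sq_matrix = "((real, 'n) vec, 'n) vec"

definition simple_graph :: "'n::finite set set \<Rightarrow> bool" where
  "simple_graph E \<longleftrightarrow> (\<forall>e\<in>E. card e = 2)"

definition adj_matrices :: "'n::finite set set \<Rightarrow> ('n sq_matrix) set" where
  "adj_matrices E = {a. (\<forall>i j. a $ i $ j \<in> {0, 1}) \<and> (\<forall>i j. a $ i $ j = a $ j $ i) \<and>
     (\<forall>i. a $ i $ i = 0) \<and> (\<forall>i j. {i, j} \<notin> E \<longrightarrow> a $ i $ j = 0)}"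

abbreviation basis_vec :: "'n::finite \<Rightarrow> real^'n" where
  "basis_vec i \<equiv> axis i 1"

definition outer :: "real^'n::finite \<Rightarrow> real^'n \<Rightarrow> 'n sq_matrix" where
  "outer u v = (columnvector u :: real^1^'n) ** transpose (columnvector v)"

definition Q_mat :: "real \<Rightarrow> real \<Rightarrow> 'n::{finite,linorder} set set \<Rightarrow> 'n sq_matrix \<Rightarrow> 'n sq_matrix" where
  "Q_mat \<alpha> \<beta> E a = \<alpha> *\<^sub>R mat 1 + \<beta> *\<^sub>R (\<Sum>(i, j)\<in>{(i, j). i < j \<and> {i, j} \<in> E}.
     a $ i $ j *\<^sub>R outer (basis_vec i - basis_vec j) (basis_vec i - basis_vec j))"

definition Sigma_mat :: "real \<Rightarrow> real \<Rightarrow> 'n::{finite,linorder} set set \<Rightarrow> 'n sq_matrix \<Rightarrow> 'n sq_matrix" where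
  "Sigma_mat \<alpha> \<beta> E a = matrix_inv (Q_mat \<alpha> \<beta> E a)"

definition var_diff :: "'n sq_matrix \<Rightarrow> 'n::finite \<Rightarrow> 'n \<Rightarrow> real" where
  "var_diff S i j = S $ i $ i + S $ j $ j - 2 * S $ i $ j"

definition delta ::
    "real \<Rightarrow> real \<Rightarrow> 'n::{finite,linorder} set set \<Rightarrow> 'n \<Rightarrow> 'n \<Rightarrow> 'n sq_matrix \<Rightarrow> real" where
  "delta \<alpha> \<beta> E i j a = var_diff (Sigma_mat \<alpha> \<beta> E a) i j"

text \<open>In the following, \<open>p\<close> and \<open>q\<close> are the end points of the edge that is added to \<open>E\<close>.\<close>

definition add_edge :: "'n::finite \<Rightarrow> 'n \<Rightarrow> 'n sq_matrix \<Rightarrow> real \<Rightarrow> 'n sq_matrix" where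
  "add_edge p q a c =
     a + c *\<^sub>R (outer (basis_vec p) (basis_vec q) + outer (basis_vec q) (basis_vec p))"

definition adj_matrices' :: "'n::finite set set \<Rightarrow> 'n \<Rightarrow> 'n \<Rightarrow> ('n sq_matrix) set" where
  "adj_matrices' E p q = {add_edge p q a c | a c. a \<in> adj_matrices E \<and> c \<in> {0, 1}}"

definition edge_part :: "'n::finite set set \<Rightarrow> 'n sq_matrix \<Rightarrow> 'n sq_matrix" where
  "edge_part E a' = (\<chi> i j. if {i, j} \<in> E then a' $ i $ j else 0)"

text \<open>\<open>edge_part\<close> recovers \<open>a\<close> from \<open>add_edge p q a c\<close>, and \<open>c\<close> is the \<open>(p, q)\<close> entry,
  so \<open>Q_mat'\<close> below is determined by the decomposition of its argument.\<close>

lemma outer_nth: "outer u v $ i $ j = u $ i * v $ j"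
  by (simp add: outer_def columnvector_def transpose_def matrix_matrix_mult_def)

lemma add_edge_entry:
  assumes "a \<in> adj_matrices E" "p \<noteq> q" "{p, q} \<notin> E"
  shows "add_edge p q a c $ p $ q = c"
  using assms by (auto simp: add_edge_def adj_matrices_def outer_nth axis_def)

lemma edge_part_add_edge:
  assumes "a \<in> adj_matrices E" "{p, q} \<notin> E"
  shows "edge_part E (add_edge p q a c) = a"
  using assms
  by (auto simp: edge_part_def add_edge_def adj_matrices_def outer_nth axis_def vec_eq_iff insert_commute)

definition Q_mat' ::
    "real \<Rightarrow> real \<Rightarrow> 'n::{finite,linorder} set set \<Rightarrow> 'n \<Rightarrow> 'n \<Rightarrow> 'n sq_matrix \<Rightarrow> 'n sq_matrix" where
  "Q_mat' \<alpha> \<beta> E p q a' = Q_mat \<alpha> \<beta> E (edge_part E a') +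
     (\<beta> * a' $ p $ q) *\<^sub>R outer (basis_vec p - basis_vec q) (basis_vec p - basis_vec q)"

definition Sigma_mat' ::
    "real \<Rightarrow> real \<Rightarrow> 'n::{finite,linorder} set set \<Rightarrow> 'n \<Rightarrow> 'n \<Rightarrow> 'n sq_matrix \<Rightarrow> 'n sq_matrix" where
  "Sigma_mat' \<alpha> \<beta> E p q a' = matrix_inv (Q_mat' \<alpha> \<beta> E p q a')"

definition delta' ::
    "real \<Rightarrow> real \<Rightarrow> 'n::{finite,linorder} set set \<Rightarrow> 'n \<Rightarrow> 'n \<Rightarrow> 'n \<Rightarrow> 'n \<Rightarrow> 'n sq_matrix \<Rightarrow> real" where
  "delta' \<alpha> \<beta> E p q i j a' = var_diff (Sigma_mat' \<alpha> \<beta> E p q a') i j"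

definition delta_1 ::
    "real \<Rightarrow> real \<Rightarrow> 'n::{finite,linorder} set set \<Rightarrow> 'n \<Rightarrow> 'n \<Rightarrow> 'n sq_matrix \<Rightarrow> real" where
  "delta_1 \<alpha> \<beta> E p q a = delta' \<alpha> \<beta> E p q p q (add_edge p q a 1)"

definition delta_0 ::
    "real \<Rightarrow> real \<Rightarrow> 'n::{finite,linorder} set set \<Rightarrow> 'n \<Rightarrow> 'n \<Rightarrow> 'n sq_matrix \<Rightarrow> real" where
  "delta_0 \<alpha> \<beta> E p q a = delta' \<alpha> \<beta> E p q p q (add_edge p q a 0)"

end

theory Submission
  imports Defs
begin

text \<open>Let \<open>w\<close> be the difference of the basis vectors at \<open>i'\<close> and \<open>j'\<close>, \<open>S\<close> the inverse of \<open>Q = Q(a)\<close>,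
  and \<open>d = w\<^sup>T S w\<close>, which is the \<open>\<delta>\<close> of the theorem. Adding the edge is the rank-one update
  \<open>Q + \<beta> w w\<^sup>T\<close>, whose determinant is \<open>(1 + \<beta> d) det Q\<close> by the matrix determinant lemma, and whose
  inverse maps \<open>w\<close> to \<open>S w / (1 + \<beta> d)\<close>. The first fact gives the ratio of the two weights that make
  up the event \<open>A = a\<close>; the second gives \<open>\<delta>\<^sub>1 = d / (1 + \<beta> d)\<close>, while \<open>\<delta>\<^sub>0 = d\<close>.\<close>

section \<open>Outer products and the determinant of a rank-one perturbation of the identity\<close>

lemma outer_mult_vec: "outer u v *v x = (v \<bullet> x) *\<^sub>R u"
  by (simp add: vec_eq_iff matrix_vector_mult_def outer_nth inner_vec_def sum_distrib_left
      sum_distrib_right mult_ac)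

lemma mult_outer: "M ** outer u v = outer (M *v u) v"
  by (simp add: vec_eq_iff matrix_matrix_mult_def matrix_vector_mult_def outer_nth
      sum_distrib_left sum_distrib_right mult_ac)

lemma outer_mult: "outer u v ** M = outer u (v v* M)"
  by (simp add: vec_eq_iff matrix_matrix_mult_def vector_matrix_mult_def outer_nth
      sum_distrib_left mult_ac)

lemma matrix_add_rdistrib: "(A + B) ** C = A ** C + B ** (C :: 'a::semiring_1^'n^'m)"
  by (simp add: vec_eq_iff matrix_matrix_mult_def sum.distrib distrib_right)

text \<open>The matrix is the identity with column \<open>k\<close> replaced by
  \<open>axis k 1 + u\<close>, so Cramer's lemma gives the \<open>k\<close>-th entry of that vector
  as its determinant.\<close>

lemma det_mat_1_add_outer_axis:
  fixes u :: "real^'n::finite"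
  shows "det (mat 1 + outer u (axis k 1)) = 1 + u $ k"
proof -
  have "(\<chi> i j. if j = k then (mat 1 *v (axis k 1 + u)) $ i else mat 1 $ i $ j) =
      mat 1 + outer u (axis k 1)"
    unfolding matrix_vector_mul_lid by (auto simp: vec_eq_iff outer_nth mat_def axis_def)
  then show ?thesis
    using cramer_lemma[where A="mat 1 :: real^'n^'n" and x="axis k 1 + u" and k=k]
    by simp
qed

text \<open>If \<open>v $ k \<noteq> 0\<close>, replacing row \<open>k\<close> of the identity by \<open>v\<close> gives an invertible \<open>P\<close> that
  conjugates \<open>I + u v\<^sup>T\<close> into \<open>I + (P u) e\<^sub>k\<^sup>T\<close>.\<close>
lemma det_mat_1_add_outer:
  fixes u v :: "real^'n::finite"
  shows "det (mat 1 + outer u v) = 1 + v \<bullet> u"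
proof (cases "v = 0")
  case True
  then have "outer u v = 0"
    by (simp add: vec_eq_iff outer_nth)
  then show ?thesis
    using True by simp
next
  case False
  then obtain k where k: "v $ k \<noteq> 0"
    by (auto simp: vec_eq_iff)
  define P :: "real^'n^'n" where "P = (\<chi> i. if i = k then v else row i (mat 1))"
  \<comment> \<open>Cramer's lemma replaces a column, whereas \<open>P\<close> has a replaced row;
    hence the transpose.\<close>
  have "transpose P = (\<chi> i j. if j = k then (mat 1 *v v) $ i else mat 1 $ i $ j)"
    unfolding matrix_vector_mul_lid by (auto simp: P_def vec_eq_iff transpose_def row_def mat_def)
  then have det_P: "det P = v $ k"
    using cramer_lemma[where A="mat 1 :: real^'n^'n" and x=v and k=k] det_transpose[of P] by simp
  have row_P: "axis k 1 v* P = v"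
    unfolding transpose_matrix_vector[symmetric] matrix_vector_mult_basis column_transpose
    by (simp add: row_def P_def vec_eq_iff)
  have Pu: "(P *v u) $ k = v \<bullet> u"
    by (simp add: P_def matrix_vector_mult_def inner_vec_def)
  have "P ** (mat 1 + outer u v) = (mat 1 + outer (P *v u) (axis k 1)) ** P"
    by (simp add: matrix_add_ldistrib matrix_add_rdistrib mult_outer outer_mult row_P)
  then have "det P * det (mat 1 + outer u v) = (1 + v \<bullet> u) * det P"
    by (metis Pu det_mat_1_add_outer_axis det_mul)
  then show ?thesis
    using k det_P by simp
qed

section \<open>Inverses, and rank-one updates of an invertible matrix\<close>

lemma
  fixes M :: "real^'n::finite^'n"
  assumes "det M \<noteq> 0"
  shows mult_matrix_inv: "M ** matrix_inv M = mat 1"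
    and matrix_inv_mult: "matrix_inv M ** M = mat 1"
proof -
  have "\<exists>B. M ** B = mat 1 \<and> B ** M = mat 1"
    using assms by (simp add: invertible_det_nz flip: invertible_def)
  \<comment> \<open>\<open>matrix_inv\<close> is a Hilbert choice, so it has its properties once
    some two-sided inverse exists.\<close>
  then have "M ** matrix_inv M = mat 1 \<and> matrix_inv M ** M = mat 1"
    unfolding matrix_inv_def by (rule someI_ex)
  then show "M ** matrix_inv M = mat 1" "matrix_inv M ** M = mat 1"
    by simp_all
qed

lemma mult_matrix_inv_vec:
  fixes M :: "real^'n::finite^'n"
  assumes "det M \<noteq> 0"
  shows "M *v (matrix_inv M *v x) = x"
  by (simp add: matrix_vector_mul_assoc mult_matrix_inv[OF assms])

lemma matrix_inv_eqI:
  fixes M :: "real^'n::finite^'n"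
  assumes "det M \<noteq> 0" "M *v y = x"
  shows "matrix_inv M *v x = y"
  unfolding assms(2)[symmetric] by (simp add: matrix_vector_mul_assoc matrix_inv_mult[OF assms(1)])

lemma det_matrix_inv:
  fixes M :: "real^'n::finite^'n"
  assumes "det M \<noteq> 0"
  shows "det (matrix_inv M) = 1 / det M"
  using assms arg_cong[OF mult_matrix_inv[OF assms], of det] by (simp add: det_mul field_simps)

text \<open>Transposing \<open>M ** matrix_inv M = mat 1\<close> makes the transposed inverse a left
  inverse of the symmetric \<open>M\<close>, and a left inverse agrees with the right inverse
  \<open>matrix_inv M\<close>.\<close>

lemma transpose_matrix_inv:
  fixes M :: "real^'n::finite^'n"
  assumes "det M \<noteq> 0" "transpose M = M"
  shows "transpose (matrix_inv M) = matrix_inv M"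
proof -
  have "transpose (matrix_inv M) ** M = mat 1"
    using arg_cong[OF mult_matrix_inv[OF assms(1)], of transpose] assms(2)
    by (simp add: matrix_transpose_mul transpose_mat)
  then show ?thesis
    by (metis assms(1) matrix_mul_assoc matrix_mul_lid matrix_mul_rid mult_matrix_inv)
qed

lemma det_add_outer:
  fixes M :: "real^'n::finite^'n"
  assumes "det M \<noteq> 0"
  shows "det (M + t *\<^sub>R outer u v) = det M * (1 + t * (v \<bullet> (matrix_inv M *v u)))"
proof -
  \<comment> \<open>Factoring out \<open>M\<close> reduces the claim to a perturbation of the
    identity.\<close>
  have "M + t *\<^sub>R outer u v = M ** (mat 1 + outer (t *\<^sub>R (matrix_inv M *v u)) v)"
    using mult_matrix_inv_vec[OF assms]
    by (simp add: matrix_add_ldistrib mult_outer matrix_vector_mult_scaleR)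
      (simp add: vec_eq_iff outer_nth)
  then show ?thesis
    by (simp add: det_mul det_mat_1_add_outer)
qed

lemma pos_def_imp_det_pos:
  fixes M :: "real^'n::finite^'n"
  assumes pos: "\<And>x. x \<noteq> 0 \<Longrightarrow> x \<bullet> (M *v x) > 0"
  shows "det M > 0"
proof (rule ccontr)
  \<comment> \<open>Along the segment from the identity to \<open>M\<close> the determinant starts
    at 1. If it ended nonpositive it would vanish somewhere, yet a kernel vector there would
    contradict positivity of the quadratic form.\<close>
  define f where "f t = det ((1 - t) *\<^sub>R mat 1 + t *\<^sub>R M)" for t :: real
  assume "\<not> det M > 0"
  then have f1: "f 1 \<le> 0" by (simp add: f_def)
  have f0: "f 0 \<ge> 0" by (simp add: f_def)
  have cont: "continuous_on {0..1} f"
    unfolding f_def det_def by (intro continuous_intros)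
  obtain t where t: "0 \<le> t" "t \<le> 1" "f t = 0"
    using IVT2'[OF f1 f0 _ cont] by auto
  then obtain x where x: "x \<noteq> 0" "((1 - t) *\<^sub>R mat 1 + t *\<^sub>R M) *v x = 0"
    using invertible_det_nz invertible_left_inverse matrix_left_invertible_ker
    unfolding f_def by metis
  have "x \<bullet> (((1 - t) *\<^sub>R mat 1 + t *\<^sub>R M) *v x) = (1 - t) * (x \<bullet> x) + t * (x \<bullet> (M *v x))"
    by (simp add: matrix_vector_mult_add_rdistrib inner_add_right flip: scaleR_matrix_vector_assoc)
  then have "(1 - t) * (x \<bullet> x) + t * (x \<bullet> (M *v x)) = 0"
    using x(2) by simp
  moreover have "x \<bullet> x > 0" "x \<bullet> (M *v x) > 0"
    using x pos by auto
  ultimately show False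
    using t by (smt (verit) mult_nonneg_nonneg mult_pos_pos)
qed


text \<open>Symmetry merges the two cross terms of the expanded quadratic form.\<close>

lemma var_diff_eq_inner:
  assumes "transpose S = S"
  shows "var_diff S p q = (axis p 1 - axis q 1) \<bullet> (S *v (axis p 1 - axis q 1))"
proof -
  have "S $ q $ p = S $ p $ q"
    using arg_cong[OF assms, of "\<lambda>X. X $ p $ q"] by (simp add: transpose_def)
  then show ?thesis
    by (simp add: var_diff_def matrix_vector_mult_diff_distrib inner_diff_left inner_axis'
        matrix_vector_mult_basis column_def)
qed

text \<open>With \<open>y = matrix_inv M *v w\<close> the form equals
  \<open>y \<bullet> (M *v y)\<close>, and \<open>y\<close> is nonzero because \<open>w\<close>
  is.\<close>

lemma inner_matrix_inv_pos:
  fixes M :: "real^'n::finite^'n"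
  assumes pos: "\<And>x. x \<noteq> 0 \<Longrightarrow> x \<bullet> (M *v x) > 0" and "w \<noteq> 0"
  shows "w \<bullet> (matrix_inv M *v w) > 0"
proof -
  have eq: "M *v (matrix_inv M *v w) = w"
    using mult_matrix_inv_vec pos_def_imp_det_pos[OF pos] by (metis less_irrefl)
  then have "matrix_inv M *v w \<noteq> 0"
    using \<open>w \<noteq> 0\<close> by (metis matrix_vector_mult_0_right)
  then show ?thesis
    using pos eq by (metis inner_commute)
qed

text \<open>The update turns \<open>M (M\<inverse> w) = w\<close> into \<open>(M + t w w\<^sup>T) (M\<inverse> w) = (1 + t d) w\<close>.\<close>
lemma inner_matrix_inv_add_outer:
  fixes M :: "real^'n::finite^'n"
  assumes det: "det M \<noteq> 0" and nz: "1 + t * (w \<bullet> (matrix_inv M *v w)) \<noteq> 0"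
  shows "w \<bullet> (matrix_inv (M + t *\<^sub>R outer w w) *v w) =
    w \<bullet> (matrix_inv M *v w) / (1 + t * (w \<bullet> (matrix_inv M *v w)))"
proof -
  define d where "d = w \<bullet> (matrix_inv M *v w)"
  let ?M' = "M + t *\<^sub>R outer w w"
  have "det ?M' \<noteq> 0"
    using det nz by (simp add: det_add_outer)
  moreover have "?M' *v (inverse (1 + t * d) *\<^sub>R (matrix_inv M *v w)) = w"
    using nz mult_matrix_inv_vec[OF det, of w]
    by (simp add: matrix_vector_mult_scaleR matrix_vector_mult_add_rdistrib
        outer_mult_vec flip: scaleR_matrix_vector_assoc d_def)
      (simp flip: scaleR_left_distrib[of 1, simplified])
  ultimately have "matrix_inv ?M' *v w = inverse (1 + t * d) *\<^sub>R (matrix_inv M *v w)"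
    by (rule matrix_inv_eqI)
  then show ?thesis
    by (simp add: d_def field_simps)
qed

section \<open>Positive definiteness and symmetry of \<open>Q_mat\<close>\<close>

lemma Q_mat_mult_vec:
  "Q_mat \<alpha> \<beta> E a *v x = \<alpha> *\<^sub>R x + \<beta> *\<^sub>R (\<Sum>(i, j)\<in>{(i, j). i < j \<and> {i, j} \<in> E}.
     (a $ i $ j * (x $ i - x $ j)) *\<^sub>R (axis i 1 - axis j 1))"
proof -
  have sum: "(\<Sum>i\<in>I. F i) *v x = (\<Sum>i\<in>I. F i *v x)" for F :: "'b \<Rightarrow> 'a sq_matrix" and I
    by (induction I rule: infinite_finite_induct) (simp_all add: matrix_vector_mult_add_rdistrib)
  show ?thesis
    by (simp add: Q_mat_def matrix_vector_mult_add_rdistrib sum case_prod_beta outer_mult_vec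
        inner_diff_left inner_axis' flip: scaleR_matrix_vector_assoc)
qed

lemma Q_mat_pos_def:
  assumes "\<alpha> > 0" "\<beta> \<ge> 0" "a \<in> adj_matrices E" "x \<noteq> 0"
  shows "x \<bullet> (Q_mat \<alpha> \<beta> E a *v x) > 0"
proof -
  have "a $ i $ j \<in> {0, 1}" for i j
    using assms(3) unfolding adj_matrices_def by blast
  then have a: "a $ i $ j \<ge> 0" for i j
    by (metis empty_iff insert_iff order_refl zero_le_one)
  \<comment> \<open>The edge terms form a graph Laplacian, whose quadratic form is a sum of squared
    differences along edges.\<close>
  have "x \<bullet> (Q_mat \<alpha> \<beta> E a *v x) = \<alpha> * (x \<bullet> x) + \<beta> * (\<Sum>(i, j)\<in>{(i, j). i < j \<and> {i, j} \<in> E}.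
     a $ i $ j * (x $ i - x $ j)\<^sup>2)"
    by (simp add: Q_mat_mult_vec inner_add_right inner_sum_right case_prod_beta inner_diff_right
        inner_axis power2_eq_square mult_ac)
  moreover have "\<beta> * (\<Sum>(i, j)\<in>{(i, j). i < j \<and> {i, j} \<in> E}. a $ i $ j * (x $ i - x $ j)\<^sup>2) \<ge> 0"
    unfolding case_prod_beta
    by (intro mult_nonneg_nonneg sum_nonneg assms(2) a zero_le_power2)
  moreover have "\<alpha> * (x \<bullet> x) > 0"
    using assms by simp
  ultimately show ?thesis by linarith
qed

lemma transpose_Q_mat: "transpose (Q_mat \<alpha> \<beta> E a) = Q_mat \<alpha> \<beta> E a"
  by (auto simp: vec_eq_iff transpose_def Q_mat_def outer_nth mat_def case_prod_beta mult_ac)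

lemma Q_mat'_add_edge:
  assumes "a \<in> adj_matrices E" "p \<noteq> q" "{p, q} \<notin> E"
  shows "Q_mat' \<alpha> \<beta> E p q (add_edge p q a c) =
    Q_mat \<alpha> \<beta> E a + (\<beta> * c) *\<^sub>R outer (axis p 1 - axis q 1) (axis p 1 - axis q 1)"
  using assms by (simp add: Q_mat'_def edge_part_add_edge add_edge_entry)

text \<open>A 0-1 matrix is determined by the positions of its ones. Finiteness makes the
  normalising sum a genuine sum rather than the default 0.\<close>

lemma finite_adj_matrices': "finite (adj_matrices' E p q)"
proof -
  have "a \<in> range (\<lambda>S. \<chi> i j. if (i, j) \<in> S then 1 else 0)" if "a \<in> adj_matrices E" for a
  proof (rule range_eqI)
    show "a = (\<chi> i j. if (i, j) \<in> {(i, j). a $ i $ j = 1} then 1 else 0)"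
      using that by (force simp: vec_eq_iff adj_matrices_def)
  qed
  then have "finite (adj_matrices E)"
    by (rule finite_subset[OF subsetI finite_imageI[OF finite]])
  moreover have "adj_matrices' E p q = (\<lambda>(a, c). add_edge p q a c) ` (adj_matrices E \<times> {0, 1})"
    by (auto simp: adj_matrices'_def)
  ultimately show ?thesis by simp
qed

section \<open>Effect of the new edge on the determinant and on \<delta>\<close>

context
  fixes \<alpha> \<beta> :: real and E :: "'n::{finite,linorder} set set" and p q :: 'n
  assumes \<alpha>: "\<alpha> > 0" and \<beta>: "\<beta> \<ge> 0" and pq: "p \<noteq> q" "{p, q} \<notin> E"
begin

lemma det_Q_mat_pos: "a \<in> adj_matrices E \<Longrightarrow> det (Q_mat \<alpha> \<beta> E a) > 0"
  using pos_def_imp_det_pos Q_mat_pos_def[OF \<alpha> \<beta>] by blast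

lemma delta_eq_inner:
  assumes "a \<in> adj_matrices E"
  shows "delta \<alpha> \<beta> E p q a =
    (axis p 1 - axis q 1) \<bullet> (matrix_inv (Q_mat \<alpha> \<beta> E a) *v (axis p 1 - axis q 1))"
  using det_Q_mat_pos[OF assms]
  by (simp add: delta_def Sigma_mat_def var_diff_eq_inner transpose_matrix_inv transpose_Q_mat)

lemma delta_pos:
  assumes "a \<in> adj_matrices E"
  shows "delta \<alpha> \<beta> E p q a > 0"
proof -
  have "axis p 1 - axis q 1 \<noteq> (0 :: (real, 'n) vec)"
    using pq by (simp add: axis_eq_axis)
  then show ?thesis
    unfolding delta_eq_inner[OF assms]
    by (intro inner_matrix_inv_pos Q_mat_pos_def \<alpha> \<beta> assms)
qed

lemma det_Q_mat':
  assumes "a \<in> adj_matrices E"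
  shows "det (Q_mat' \<alpha> \<beta> E p q (add_edge p q a c)) =
    det (Q_mat \<alpha> \<beta> E a) * (1 + \<beta> * c * delta \<alpha> \<beta> E p q a)"
  using det_Q_mat_pos[OF assms]
  by (simp add: Q_mat'_add_edge assms pq det_add_outer delta_eq_inner)

lemma det_Q_mat'_pos:
  assumes "a \<in> adj_matrices E" "c \<ge> 0"
  shows "det (Q_mat' \<alpha> \<beta> E p q (add_edge p q a c)) > 0"
  unfolding det_Q_mat'[OF assms(1)] using assms \<beta> det_Q_mat_pos delta_pos
  by (intro mult_pos_pos add_pos_nonneg mult_nonneg_nonneg) (auto intro: less_imp_le)

lemma sqrt_det_Sigma_mat':
  assumes "a \<in> adj_matrices E" "c \<ge> 0"
  shows "sqrt (det (Sigma_mat' \<alpha> \<beta> E p q (add_edge p q a c))) =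
    1 / (sqrt (det (Q_mat \<alpha> \<beta> E a)) * sqrt (1 + \<beta> * c * delta \<alpha> \<beta> E p q a))"
  unfolding Sigma_mat'_def det_matrix_inv[OF less_imp_neq[OF det_Q_mat'_pos[OF assms], symmetric]]
  by (simp add: det_Q_mat'[OF assms(1)] real_sqrt_divide real_sqrt_mult)

lemma delta'_add_edge:
  assumes "a \<in> adj_matrices E" "c \<ge> 0"
  shows "delta' \<alpha> \<beta> E p q p q (add_edge p q a c) =
    delta \<alpha> \<beta> E p q a / (1 + \<beta> * c * delta \<alpha> \<beta> E p q a)"
proof -
  let ?Q = "Q_mat' \<alpha> \<beta> E p q (add_edge p q a c)"
  have "transpose ?Q = ?Q"
    using transpose_Q_mat[of \<alpha> \<beta> E a]
    by (auto simp: Q_mat'_add_edge assms pq vec_eq_iff transpose_def outer_nth mult_ac)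
  then have "delta' \<alpha> \<beta> E p q p q (add_edge p q a c) =
      (axis p 1 - axis q 1) \<bullet> (matrix_inv ?Q *v (axis p 1 - axis q 1))"
    using det_Q_mat'_pos[OF assms]
    by (simp add: delta'_def Sigma_mat'_def var_diff_eq_inner transpose_matrix_inv)
  \<comment> \<open>The denominator is nonzero because it is a factor of the positive determinant of
    \<open>?Q\<close>.\<close>
  also have "\<dots> = delta \<alpha> \<beta> E p q a / (1 + \<beta> * c * delta \<alpha> \<beta> E p q a)"
    unfolding Q_mat'_add_edge[OF assms(1) pq] delta_eq_inner[OF assms(1)]
    using det_Q_mat'_pos[OF assms] det_Q_mat_pos[OF assms(1)]
    by (intro inner_matrix_inv_add_outer) (auto simp: det_Q_mat' assms delta_eq_inner)
  finally show ?thesis .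
qed

end

theorem proposition2:
  fixes \<alpha> \<beta> :: real
    and E :: "'n::{finite,linorder} set set"
    and i' j' :: 'n
    and a :: "'n sq_matrix"
    and \<mu>' :: "'w measure"
    and A' :: "'w \<Rightarrow> 'n sq_matrix"
  assumes "\<alpha> > 0" and "\<beta> \<ge> 0"
    and "simple_graph E"
    and "i' \<noteq> j'" and "{i', j'} \<notin> E"
    and "prob_space \<mu>'"
    and "A' \<in> measurable \<mu>' (count_space (adj_matrices' E i' j'))"
    and "\<And>a'. a' \<in> adj_matrices' E i' j' \<Longrightarrow>
      \<P>(\<omega> in \<mu>'. A' \<omega> = a') =
        sqrt (det (Sigma_mat' \<alpha> \<beta> E i' j' a')) /
        (\<Sum>b'\<in>adj_matrices' E i' j'. sqrt (det (Sigma_mat' \<alpha> \<beta> E i' j' b')))"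
    and "a \<in> adj_matrices E"
  shows "\<P>(\<omega> in \<mu>'. A' \<omega> $ i' $ j' = 1 \<bar> edge_part E (A' \<omega>) = a) =
      1 / (1 + sqrt (1 + \<beta> * delta \<alpha> \<beta> E i' j' a)) \<and>
    \<P>(\<omega> in \<mu>'. A' \<omega> $ i' $ j' = 1 \<bar> edge_part E (A' \<omega>) = a) =
      sqrt (delta_1 \<alpha> \<beta> E i' j' a) /
      (sqrt (delta_0 \<alpha> \<beta> E i' j' a) + sqrt (delta_1 \<alpha> \<beta> E i' j' a))"
proof -
  interpret prob_space \<mu>' by fact
  note pos = assms(1,2,4,5)
  define d where "d = delta \<alpha> \<beta> E i' j' a"
  define D where "D = sqrt (det (Q_mat \<alpha> \<beta> E a))"
  define s where "s = sqrt (1 + \<beta> * d)"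
  define b where "b c = add_edge i' j' a c" for c
  define Z where "Z = (\<Sum>b'\<in>adj_matrices' E i' j'. sqrt (det (Sigma_mat' \<alpha> \<beta> E i' j' b')))"
  have d: "d > 0"
    unfolding d_def using delta_pos[OF pos assms(9)] .
  have D: "D > 0"
    unfolding D_def using det_Q_mat_pos[OF pos assms(9)] by simp
  have s: "s > 0"
    unfolding s_def using d assms(2) by (simp add: add_pos_nonneg)
  have b_in: "b c \<in> adj_matrices' E i' j'" if "c \<in> {0, 1}" for c
    using that assms(9) by (auto simp: b_def adj_matrices'_def)
  \<comment> \<open>Positivity allows \<open>Z\<close> to be cancelled from the conditional
    probability.\<close>
  have Z: "Z > 0"
    unfolding Z_def
  proof (rule sum_pos)
    show "finite (adj_matrices' E i' j')" by (rule finite_adj_matrices')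
    show "adj_matrices' E i' j' \<noteq> {}" using b_in by blast
    fix b' assume "b' \<in> adj_matrices' E i' j'"
    then obtain a0 c where "b' = add_edge i' j' a0 c" "a0 \<in> adj_matrices E" "c \<ge> 0"
      by (auto simp: adj_matrices'_def)
    then show "sqrt (det (Sigma_mat' \<alpha> \<beta> E i' j' b')) > 0"
      using det_Q_mat'_pos[OF pos] by (simp add: Sigma_mat'_def det_matrix_inv less_imp_neq[symmetric])
  qed
  have meas: "{\<omega> \<in> space \<mu>'. A' \<omega> = b'} \<in> events" if "b' \<in> adj_matrices' E i' j'" for b'
    using measurable_sets[OF assms(7), of "{b'}"] that
    by (simp add: vimage_def Int_def conj_commute)
  \<comment> \<open>The fibre of \<open>edge_part E\<close> over \<open>a\<close> is the pair
    \<open>b 0\<close>, \<open>b 1\<close>, so conditioning compares just two weights.\<close>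
  have decomp: "edge_part E b' = a \<longleftrightarrow> b' = b 0 \<or> b' = b 1"
    if "b' \<in> adj_matrices' E i' j'" for b'
    using that assms(4,5,9)
    by (auto simp: adj_matrices'_def b_def edge_part_add_edge)
  have A': "A' \<omega> \<in> adj_matrices' E i' j'" if "\<omega> \<in> space \<mu>'" for \<omega>
    using measurable_space[OF assms(7) that] by simp
  have b01: "b 0 $ i' $ j' = 0" "b 1 $ i' $ j' = 1"
    using assms(4,5,9) by (simp_all add: b_def add_edge_entry)
  have p0: "\<P>(\<omega> in \<mu>'. A' \<omega> = b 0) = 1 / D / Z"
    using assms(8)[OF b_in[of 0]] sqrt_det_Sigma_mat'[OF pos assms(9), of 0]
    by (simp add: b_def D_def Z_def)
  have p1: "\<P>(\<omega> in \<mu>'. A' \<omega> = b 1) = 1 / (D * s) / Z"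
    using assms(8)[OF b_in[of 1]] sqrt_det_Sigma_mat'[OF pos assms(9), of 1]
    by (simp add: b_def D_def Z_def s_def d_def)
  have "{\<omega> \<in> space \<mu>'. A' \<omega> $ i' $ j' = 1 \<and> edge_part E (A' \<omega>) = a} =
      {\<omega> \<in> space \<mu>'. A' \<omega> = b 1}"
    by (rule Collect_cong) (metis A' decomp b01 zero_neq_one)
  moreover have "{\<omega> \<in> space \<mu>'. edge_part E (A' \<omega>) = a} =
      {\<omega> \<in> space \<mu>'. A' \<omega> = b 0} \<union> {\<omega> \<in> space \<mu>'. A' \<omega> = b 1}"
    using A' decomp by blast
  \<comment> \<open>The two events are disjoint since \<open>b 0\<close> and \<open>b 1\<close>
    differ in the entry at \<open>i'\<close>, \<open>j'\<close>.\<close>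
  moreover have "prob ({\<omega> \<in> space \<mu>'. A' \<omega> = b 0} \<union> {\<omega> \<in> space \<mu>'. A' \<omega> = b 1}) =
      1 / D / Z + 1 / (D * s) / Z"
    unfolding p0[symmetric] p1[symmetric] using b01
    by (intro finite_measure_Union meas b_in) auto
  ultimately have "\<P>(\<omega> in \<mu>'. A' \<omega> $ i' $ j' = 1 \<bar> edge_part E (A' \<omega>) = a) =
      (1 / (D * s) / Z) / (1 / D / Z + 1 / (D * s) / Z)"
    by (simp add: cond_prob_def p1)
  \<comment> \<open>Cancelling \<open>1 / (D * Z)\<close> leaves
    \<open>(1 / s) / (1 + 1 / s)\<close>.\<close>
  also have "\<dots> = 1 / (1 + s)"
    using D Z s by (simp add: divide_simps)
  finally have cond: "\<P>(\<omega> in \<mu>'. A' \<omega> $ i' $ j' = 1 \<bar> edge_part E (A' \<omega>) = a) = 1 / (1 + s)" .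
  have "sqrt (delta_0 \<alpha> \<beta> E i' j' a) = sqrt d" "sqrt (delta_1 \<alpha> \<beta> E i' j' a) = sqrt d / s"
    using delta'_add_edge[OF pos assms(9)]
    by (simp_all add: delta_0_def delta_1_def d_def s_def real_sqrt_divide)
  \<comment> \<open>Here \<open>sqrt d\<close> cancels, which turns the second formula into the
    first.\<close>
  moreover have "(sqrt d / s) / (sqrt d + sqrt d / s) = 1 / (1 + s)"
    using d s add_pos_pos[of "sqrt d" "s * sqrt d"] by (simp add: divide_simps algebra_simps)
  ultimately show ?thesis
    using cond by (simp add: s_def d_def)
qed

end
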